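(* Let $G=(V,E)$ be a graph with $n=|E|$, $E=\{1,\dots,n\}$, and let $\mathbf x=(x_1,\dots,x_n)\in\mathbb F_2^n$. Then $$FH_G(x_1,\dots,x_n)=\sum_{T\in\mathcal T_G}\Big(\prod_{i\in E(T)}(1-2x_i)\Big),$$ where on the right-hand side the $x_i$ are read as the integers $0,1$.
   Context: Graphs are finite and may have loops and multiple edges. $\mathcal T_G$ is the set of spanning trees of $G$, and $E(T)$ is the edge set of $T$. For $T\in\mathcal T_G$, $\mathbf v_T\in\mathbb F_2^n$ is the characteristic vector of $E(T)$ ($i$-th entry $1$ iff $i\in E(T)$). $f_G:\mathbb F_2^n\to\mathbb F_2$ is the Boolean function with support $\{\mathbf v_T:T\in\mathcal T_G\}$. Its Fourier-Hadamard transform is $\widehat f_G(\mathbf u)=\sum_{T\in\mathcal T_G}(-1)^{\mathbf v_T\cdot\mathbf u}\in\mathbb Z$, with $\mathbf x\cdot\mathbf u=x_1u_1\oplus\cdots\oplus x_nu_n$ (sum mod 2). The $FH_G$-polynomial $FH_G(x_1,\dots,x_n)$ is the Numerical Normal Form of $\widehat f_G$, i.e. its representative in $\mathbb R[x_1,\dots,x_n]/(x_1^2-x_1,\dots,x_n^2-x_n)$ (coordinates in $\mathbb F_2$ being read as real numbers $0,1$); thus $FH_G(x_1,\dots,x_n)=\widehat f_G(x_1,\dots,x_n)$. *)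

theory Defs
  imports Complex_Main "HOL-Library.FuncSet" "HOL-Library.Z2" "HOL-Library.Poly_Mapping"
begin

section \<open>Multigraphs and spanning trees\<close>

text \<open>
  An edge \<open>e\<close> is incident with the vertices in \<open>ends G e\<close>: two vertices, or one if \<open>e\<close> is a
  loop. Parallel edges are distinct edges with the same set of ends.
\<close>

record 'v multigraph =
  verts :: "'v set"
  edges :: "nat set"
  ends :: "nat \<Rightarrow> 'v set"

definition wf_multigraph :: "'v multigraph \<Rightarrow> bool" where
  "wf_multigraph G \<longleftrightarrow>
     (\<forall>e \<in> edges G. ends G e \<subseteq> verts G \<and> (card (ends G e) = 1 \<or> card (ends G e) = 2))"

definition finite_multigraph :: "'v multigraph \<Rightarrow> bool" where
  "finite_multigraph G \<longleftrightarrow> wf_multigraph G \<and> finite (verts G) \<and> finite (edges G)"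

text \<open>
  The two \<open>ends\<close> fields must agree on all of \<open>nat\<close>, so that a subgraph is
  determined by its vertex set and its edge set.
\<close>

definition subgraph :: "'v multigraph \<Rightarrow> 'v multigraph \<Rightarrow> bool" where
  "subgraph H G \<longleftrightarrow>
     wf_multigraph H \<and> verts H \<subseteq> verts G \<and> edges H \<subseteq> edges G \<and> ends H = ends G"

definition adjacency :: "'v multigraph \<Rightarrow> ('v \<times> 'v) set" where
  "adjacency G = {(u, v). \<exists>e \<in> edges G. ends G e = {u, v}}"

definition connected_graph :: "'v multigraph \<Rightarrow> bool" where
  "connected_graph G \<longleftrightarrow>
     verts G \<noteq> {} \<and> (\<forall>u \<in> verts G. \<forall>v \<in> verts G. (u, v) \<in> (adjacency G)\<^sup>*)"

text \<open>
  The vertices \<open>vs\<close> and the edges \<open>es\<close> of a cycle in cyclic order. A loop is a cycle of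
  length 1, and two parallel edges form a cycle of length 2.
\<close>

definition is_cycle :: "'v multigraph \<Rightarrow> 'v list \<Rightarrow> nat list \<Rightarrow> bool" where
  "is_cycle G vs es \<longleftrightarrow>
     vs \<noteq> [] \<and> length es = length vs \<and> distinct vs \<and> distinct es \<and> set es \<subseteq> edges G \<and>
     (\<forall>i < length vs. ends G (es ! i) = {vs ! i, vs ! (Suc i mod length vs)})"

definition is_tree :: "'v multigraph \<Rightarrow> bool" where
  "is_tree G \<longleftrightarrow> connected_graph G \<and> (\<nexists>vs es. is_cycle G vs es)"

definition spanning_trees :: "'v multigraph \<Rightarrow> 'v multigraph set" where
  "spanning_trees G = {T. subgraph T G \<and> verts T = verts G \<and> is_tree T}"


section \<open>Boolean functions and the Fourier-Hadamard transform\<close>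

definition F2 :: "nat \<Rightarrow> (nat \<Rightarrow> bit) set" where
  "F2 n = {1..n} \<rightarrow>\<^sub>E UNIV"

definition bit_val :: "bit \<Rightarrow> 'a::zero_neq_one" where
  "bit_val b = of_bool (b = 1)"

definition dot :: "nat \<Rightarrow> (nat \<Rightarrow> bit) \<Rightarrow> (nat \<Rightarrow> bit) \<Rightarrow> bit" where
  "dot n v u = (\<Sum>i = 1..n. v i * u i)"

definition fourier_hadamard :: "nat \<Rightarrow> ((nat \<Rightarrow> bit) \<Rightarrow> bit) \<Rightarrow> (nat \<Rightarrow> bit) \<Rightarrow> int" where
  "fourier_hadamard n f u = (\<Sum>v \<in> F2 n. bit_val (f v) * (- 1) ^ bit_val (dot n v u))"

definition char_vec :: "nat \<Rightarrow> nat set \<Rightarrow> nat \<Rightarrow> bit" where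
  "char_vec n S = (\<lambda>i \<in> {1..n}. if i \<in> S then 1 else 0)"

definition tree_function :: "'v multigraph \<Rightarrow> (nat \<Rightarrow> bit) \<Rightarrow> bit" where
  "tree_function G v =
     (if v \<in> (\<lambda>T. char_vec (card (edges G)) (edges T)) ` spanning_trees G then 1 else 0)"

lemma fourier_hadamard_tree_function:
  fixes G :: "'v multigraph"
  assumes "edges G = {1..n}"
  shows "fourier_hadamard n (tree_function G) u =
           (\<Sum>T \<in> spanning_trees G. (- 1) ^ bit_val (dot n (char_vec n (edges T)) u))"
proof -
  let ?v = "\<lambda>T :: 'v multigraph. char_vec n (edges T)"
  have inj: "inj_on ?v (spanning_trees G)"
  proof (rule inj_onI)
    fix S T assume S: "S \<in> spanning_trees G" and T: "T \<in> spanning_trees G" and eq: "?v S = ?v T"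
    have "i \<in> edges S \<longleftrightarrow> i \<in> edges T" if "i \<in> {1..n}" for i
      using fun_cong[OF eq, of i] that by (simp add: char_vec_def split: if_splits)
    moreover have "edges S \<subseteq> {1..n}" "edges T \<subseteq> {1..n}"
      using S T assms by (auto simp: spanning_trees_def subgraph_def)
    ultimately have "edges S = edges T" by blast
    with S T show "S = T" by (simp add: spanning_trees_def subgraph_def)
  qed
  have "b \<in> {0, 1}" for b :: bit by (cases b) auto
  then have "finite (UNIV :: bit set)" by (intro finite_subset[of UNIV "{0, 1}"]) auto
  then have fin: "finite (F2 n)" by (simp add: F2_def finite_PiE)
  have sub: "?v ` spanning_trees G \<subseteq> F2 n" by (auto simp: F2_def char_vec_def)
  have "fourier_hadamard n (tree_function G) u =
          (\<Sum>v \<in> F2 n. if v \<in> ?v ` spanning_trees G then (- 1) ^ bit_val (dot n v u) else 0)"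
    unfolding fourier_hadamard_def tree_function_def
    by (rule sum.cong) (auto simp: assms bit_val_def)
  also have "\<dots> = (\<Sum>v \<in> ?v ` spanning_trees G. (- 1) ^ bit_val (dot n v u))"
    using fin sub by (simp add: sum.If_cases Int_absorb1)
  also have "\<dots> = (\<Sum>T \<in> spanning_trees G. (- 1) ^ bit_val (dot n (?v T) u))"
    by (simp add: sum.reindex[OF inj])
  finally show ?thesis .
qed


section \<open>Numerical normal forms\<close>

text \<open>
  Polynomials are finitely supported functions from monomials to coefficients, a monomial
  being a finitely supported function from variable indices to exponents.
\<close>

type_synonym mpoly = "(nat \<Rightarrow>\<^sub>0 nat) \<Rightarrow>\<^sub>0 real"

definition PolyConst :: "real \<Rightarrow> mpoly" where
  "PolyConst c = Poly_Mapping.single 0 c"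

definition PolyVar :: "nat \<Rightarrow> mpoly" where
  "PolyVar i = Poly_Mapping.single (Poly_Mapping.single i 1) 1"

definition poly_ring :: "nat \<Rightarrow> mpoly set" where
  "poly_ring n = {p. \<forall>m \<in> Poly_Mapping.keys p. Poly_Mapping.keys m \<subseteq> {1..n}}"

definition poly_eval :: "mpoly \<Rightarrow> (nat \<Rightarrow> real) \<Rightarrow> real" where
  "poly_eval p a = (\<Sum>m \<in> Poly_Mapping.keys p. Poly_Mapping.lookup p m * (\<Prod>i \<in> Poly_Mapping.keys m. a i ^ Poly_Mapping.lookup m i))"

definition bool_ideal :: "nat \<Rightarrow> mpoly set" where
  "bool_ideal n =
     {\<Sum>i = 1..n. q i * (PolyVar i ^ 2 - PolyVar i) | q. \<forall>i \<in> {1..n}. q i \<in> poly_ring n}"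

definition bool_cong :: "nat \<Rightarrow> (mpoly \<times> mpoly) set" where
  "bool_cong n = {(p, q). p \<in> poly_ring n \<and> q \<in> poly_ring n \<and> p - q \<in> bool_ideal n}"

definition eval_at :: "mpoly \<Rightarrow> (nat \<Rightarrow> bit) \<Rightarrow> real" where
  "eval_at p x = poly_eval p (\<lambda>i. bit_val (x i))"

text \<open>
  The numerical normal form of a real-valued function on \<open>F2 n\<close> is an element of the quotient
  ring, that is, a residue class of polynomials; lemma \<open>NNF_ex1\<close> below shows that it is
  well-defined.
\<close>

definition NNF :: "nat \<Rightarrow> ((nat \<Rightarrow> bit) \<Rightarrow> real) \<Rightarrow> mpoly set" where
  "NNF n \<phi> = (THE C. C \<in> poly_ring n // bool_cong n \<and> (\<forall>p \<in> C. \<forall>x \<in> F2 n. eval_at p x = \<phi> x))"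

definition class_eval :: "mpoly set \<Rightarrow> (nat \<Rightarrow> bit) \<Rightarrow> real" where
  "class_eval C x = (THE c. \<forall>p \<in> C. eval_at p x = c)"

lemma mpoly_induct [case_names zero single_add]:
  assumes "P (0 :: mpoly)"
    and "\<And>m c p. m \<notin> Poly_Mapping.keys p \<Longrightarrow> c \<noteq> 0 \<Longrightarrow> P p \<Longrightarrow> P (Poly_Mapping.single m c + p)"
  shows "P p"
proof (induction p rule: Poly_Mapping.update_induct)
  case const
  show ?case by (rule assms(1))
next
  case (update f a b)
  have "Poly_Mapping.update a b f = Poly_Mapping.single a b + f"
    by (rule poly_mapping_eqI)
      (use update(1) in \<open>auto simp: lookup_update lookup_add lookup_single when_def in_keys_iff\<close>)
  with assms(2)[OF update] show ?case by simp
qed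

lemma poly_eval_superset:
  assumes "finite K" "Poly_Mapping.keys p \<subseteq> K"
  shows "poly_eval p a =
           (\<Sum>m \<in> K. Poly_Mapping.lookup p m * (\<Prod>i \<in> Poly_Mapping.keys m. a i ^ Poly_Mapping.lookup m i))"
  unfolding poly_eval_def using assms
  by (intro sum.mono_neutral_left) (auto simp: in_keys_iff)

lemma poly_eval_add: "poly_eval (p + q) a = poly_eval p a + poly_eval q a"
proof -
  let ?K = "Poly_Mapping.keys p \<union> Poly_Mapping.keys q"
  have K: "finite ?K" by simp
  show ?thesis
    using poly_eval_superset[OF K, of p a] poly_eval_superset[OF K, of q a]
      poly_eval_superset[OF K keys_add, of a]
    by (simp add: lookup_add sum.distrib distrib_right)
qed

lemma poly_eval_single:
  "poly_eval (Poly_Mapping.single m c) a = c * (\<Prod>i \<in> Poly_Mapping.keys m. a i ^ Poly_Mapping.lookup m i)"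
  by (simp add: poly_eval_def)

lemma poly_eval_0 [simp]: "poly_eval 0 a = 0"
  by (simp add: poly_eval_def)

lemma poly_eval_uminus: "poly_eval (- p) a = - poly_eval p a"
  using poly_eval_add[of p "- p" a] by simp

lemma poly_eval_diff: "poly_eval (p - q) a = poly_eval p a - poly_eval q a"
  using poly_eval_add[of p "- q" a] by (simp add: poly_eval_uminus)

lemma monomial_eval_add:
  fixes a :: "nat \<Rightarrow> real" and k m :: "nat \<Rightarrow>\<^sub>0 nat"
  shows "(\<Prod>i \<in> Poly_Mapping.keys (k + m). a i ^ Poly_Mapping.lookup (k + m) i) =
           (\<Prod>i \<in> Poly_Mapping.keys k. a i ^ Poly_Mapping.lookup k i) *
           (\<Prod>i \<in> Poly_Mapping.keys m. a i ^ Poly_Mapping.lookup m i)"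
proof -
  let ?K = "Poly_Mapping.keys k \<union> Poly_Mapping.keys m"
  have sup: "(\<Prod>i \<in> Poly_Mapping.keys l. a i ^ Poly_Mapping.lookup l i) =
               (\<Prod>i \<in> ?K. a i ^ Poly_Mapping.lookup l i)" if "Poly_Mapping.keys l \<subseteq> ?K" for l
    using that by (intro prod.mono_neutral_left) (auto simp: in_keys_iff)
  show ?thesis
    using sup[of k] sup[of m] sup[OF keys_add]
    by (simp add: lookup_add power_add prod.distrib)
qed

lemma poly_eval_mult: "poly_eval (p * q) a = poly_eval p a * poly_eval q a"
proof (induction p rule: mpoly_induct)
  case zero
  show ?case by simp
next
  case (single_add m c p)
  have "poly_eval (Poly_Mapping.single m c * q) a = poly_eval (Poly_Mapping.single m c) a * poly_eval q a"
  proof (induction q rule: mpoly_induct)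
    case zero
    show ?case by simp
  next
    case (single_add k d q)
    then show ?case
      by (simp add: distrib_left poly_eval_add mult_single poly_eval_single monomial_eval_add)
  qed
  with single_add show ?case
    by (simp add: distrib_right poly_eval_add)
qed

lemma poly_eval_Const [simp]: "poly_eval (PolyConst c) a = c"
  by (simp add: PolyConst_def poly_eval_single)

lemma poly_eval_Var [simp]: "poly_eval (PolyVar i) a = a i"
  by (simp add: PolyVar_def poly_eval_single)

lemma poly_eval_1 [simp]: "poly_eval 1 a = 1"
  using poly_eval_Const[of 1 a] by (simp add: PolyConst_def)

lemma poly_eval_sum: "poly_eval (\<Sum>i \<in> A. f i) a = (\<Sum>i \<in> A. poly_eval (f i) a)"
  by (induction A rule: infinite_finite_induct) (auto simp: poly_eval_add)

lemma poly_eval_prod: "poly_eval (\<Prod>i \<in> A. f i) a = (\<Prod>i \<in> A. poly_eval (f i) a)"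
  by (induction A rule: infinite_finite_induct) (auto simp: poly_eval_mult)

lemmas poly_eval_simps =
  poly_eval_add poly_eval_diff poly_eval_uminus poly_eval_mult poly_eval_sum poly_eval_prod

lemma poly_ring_0 [simp]: "0 \<in> poly_ring n"
  by (simp add: poly_ring_def)

lemma poly_ring_Const [simp]: "PolyConst c \<in> poly_ring n"
  by (simp add: poly_ring_def PolyConst_def)

lemma poly_ring_1 [simp]: "1 \<in> poly_ring n"
  by (simp add: poly_ring_def)

lemma poly_ring_Var: "i \<in> {1..n} \<Longrightarrow> PolyVar i \<in> poly_ring n"
  by (simp add: poly_ring_def PolyVar_def)

lemma poly_ring_add: "p \<in> poly_ring n \<Longrightarrow> q \<in> poly_ring n \<Longrightarrow> p + q \<in> poly_ring n"
  using keys_add[of p q] by (fastforce simp: poly_ring_def)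

lemma poly_ring_uminus: "p \<in> poly_ring n \<Longrightarrow> - p \<in> poly_ring n"
  by (simp add: poly_ring_def in_keys_iff)

lemma poly_ring_diff: "p \<in> poly_ring n \<Longrightarrow> q \<in> poly_ring n \<Longrightarrow> p - q \<in> poly_ring n"
  using poly_ring_add[of p n "- q"] poly_ring_uminus[of q n] by simp

lemma poly_ring_mult:
  assumes "p \<in> poly_ring n" "q \<in> poly_ring n"
  shows "p * q \<in> poly_ring n"
  unfolding poly_ring_def
proof (intro CollectI ballI)
  fix m assume "m \<in> Poly_Mapping.keys (p * q)"
  then obtain k l where "m = k + l" "k \<in> Poly_Mapping.keys p" "l \<in> Poly_Mapping.keys q"
    using keys_mult[of p q] by blast
  with assms keys_add[of k l] show "Poly_Mapping.keys m \<subseteq> {1..n}"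
    unfolding poly_ring_def by blast
qed

lemma poly_ring_sum: "(\<And>i. i \<in> A \<Longrightarrow> f i \<in> poly_ring n) \<Longrightarrow> (\<Sum>i \<in> A. f i) \<in> poly_ring n"
  by (induction A rule: infinite_finite_induct) (auto intro: poly_ring_add)

lemma poly_ring_prod: "(\<And>i. i \<in> A \<Longrightarrow> f i \<in> poly_ring n) \<Longrightarrow> (\<Prod>i \<in> A. f i) \<in> poly_ring n"
  by (induction A rule: infinite_finite_induct) (auto intro: poly_ring_mult)

lemma single_in_generated:
  assumes "Poly_Mapping.keys m \<subseteq> {1..n}"
    and cst: "\<And>c. PolyConst c \<in> S"
    and var: "\<And>i. i \<in> {1..n} \<Longrightarrow> PolyVar i \<in> S"
    and mult: "\<And>p q. p \<in> S \<Longrightarrow> q \<in> S \<Longrightarrow> p * q \<in> S"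
  shows "Poly_Mapping.single m c \<in> S"
  using assms(1)
proof (induction m rule: Poly_Mapping.update_induct)
  case const
  show ?case using cst[of c] by (simp add: PolyConst_def)
next
  case (update f a b)
  have upd: "Poly_Mapping.update a b f = f + Poly_Mapping.single a b"
    by (rule poly_mapping_eqI)
      (use update(1) in \<open>auto simp: lookup_update lookup_add lookup_single when_def in_keys_iff\<close>)
  have keys: "Poly_Mapping.keys f \<subseteq> {1..n}" "a \<in> {1..n}"
    using update by (auto simp: keys_update split: if_splits)
  have "Poly_Mapping.single (Poly_Mapping.single a k) 1 \<in> S" for k
  proof (induction k)
    case 0
    show ?case using cst[of 1] by (simp add: PolyConst_def)
  next
    case (Suc k)
    have "Poly_Mapping.single (Poly_Mapping.single a (Suc k)) 1 =
            PolyVar a * Poly_Mapping.single (Poly_Mapping.single a k) 1"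
      by (simp add: PolyVar_def mult_single flip: single_add)
    with mult[OF var[OF keys(2)] Suc] show ?case by simp
  qed
  from mult[OF update(3)[OF keys(1)] this[of b]] show ?case
    by (simp add: upd mult_single)
qed

lemma poly_ring_generated:
  assumes "p \<in> poly_ring n"
    and cst: "\<And>c. PolyConst c \<in> S"
    and var: "\<And>i. i \<in> {1..n} \<Longrightarrow> PolyVar i \<in> S"
    and add: "\<And>p q. p \<in> S \<Longrightarrow> q \<in> S \<Longrightarrow> p + q \<in> S"
    and mult: "\<And>p q. p \<in> S \<Longrightarrow> q \<in> S \<Longrightarrow> p * q \<in> S"
  shows "p \<in> S"
  using assms(1)
proof (induction p rule: mpoly_induct)
  case zero
  show ?case using cst[of 0] by (simp add: PolyConst_def)
next
  case (single_add m c p)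
  have "Poly_Mapping.keys (Poly_Mapping.single m c + p) = insert m (Poly_Mapping.keys p)"
    using single_add(1,2)
    by (auto simp: in_keys_iff lookup_add lookup_single when_def split: if_splits)
  then have "Poly_Mapping.keys m \<subseteq> {1..n}" "p \<in> poly_ring n"
    using single_add(4) by (auto simp: poly_ring_def)
  with single_add(3) show ?case
    by (intro add single_in_generated[of m n S c] cst var mult) auto
qed

lemma bool_ideal_0 [simp]: "0 \<in> bool_ideal n"
  unfolding bool_ideal_def by (intro CollectI exI[of _ "\<lambda>_. 0"]) simp

lemma bool_ideal_add:
  assumes "p \<in> bool_ideal n" "q \<in> bool_ideal n"
  shows "p + q \<in> bool_ideal n"
proof -
  obtain f g where f: "p = (\<Sum>i = 1..n. f i * (PolyVar i ^ 2 - PolyVar i))" "\<forall>i \<in> {1..n}. f i \<in> poly_ring n"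
    and g: "q = (\<Sum>i = 1..n. g i * (PolyVar i ^ 2 - PolyVar i))" "\<forall>i \<in> {1..n}. g i \<in> poly_ring n"
    using assms unfolding bool_ideal_def by blast
  have "p + q = (\<Sum>i = 1..n. (f i + g i) * (PolyVar i ^ 2 - PolyVar i))"
    by (simp add: f(1) g(1) distrib_right sum.distrib)
  with f(2) g(2) show ?thesis
    unfolding bool_ideal_def by (intro CollectI exI[of _ "\<lambda>i. f i + g i"]) (auto intro: poly_ring_add)
qed

lemma bool_ideal_mult:
  assumes "r \<in> poly_ring n" "p \<in> bool_ideal n"
  shows "r * p \<in> bool_ideal n"
proof -
  obtain f where f: "p = (\<Sum>i = 1..n. f i * (PolyVar i ^ 2 - PolyVar i))" "\<forall>i \<in> {1..n}. f i \<in> poly_ring n"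
    using assms(2) unfolding bool_ideal_def by blast
  have "r * p = (\<Sum>i = 1..n. (r * f i) * (PolyVar i ^ 2 - PolyVar i))"
    by (simp add: f(1) sum_distrib_left mult.assoc)
  with f(2) assms(1) show ?thesis
    unfolding bool_ideal_def by (intro CollectI exI[of _ "\<lambda>i. r * f i"]) (auto intro: poly_ring_mult)
qed

lemma bool_ideal_uminus: "p \<in> bool_ideal n \<Longrightarrow> - p \<in> bool_ideal n"
  using bool_ideal_mult[of "- 1" n p] poly_ring_uminus[OF poly_ring_1] by simp

lemma bool_ideal_sum: "(\<And>i. i \<in> A \<Longrightarrow> f i \<in> bool_ideal n) \<Longrightarrow> (\<Sum>i \<in> A. f i) \<in> bool_ideal n"
  by (induction A rule: infinite_finite_induct) (auto intro: bool_ideal_add)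

lemma bool_ideal_gen:
  assumes "i \<in> {1..n}"
  shows "PolyVar i ^ 2 - PolyVar i \<in> bool_ideal n"
proof -
  have "(\<Sum>j = 1..n. (if j = i then 1 else 0) * (PolyVar j ^ 2 - PolyVar j)) =
          (\<Sum>j = 1..n. if j = i then PolyVar j ^ 2 - PolyVar j else 0)"
    by (rule sum.cong) auto
  also have "\<dots> = PolyVar i ^ 2 - PolyVar i" using assms by simp
  finally show ?thesis
    unfolding bool_ideal_def by (intro CollectI exI[of _ "\<lambda>j. if j = i then 1 else 0"]) auto
qed

lemma eval_at_bool_ideal:
  assumes "p \<in> bool_ideal n"
  shows "eval_at p x = 0"
proof -
  have "bit_val b * bit_val b - bit_val b = (0 :: real)" for b
    unfolding bit_val_def by (cases "b = 1") simp_all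
  with assms show ?thesis
    unfolding bool_ideal_def eval_at_def by (auto simp: poly_eval_simps power2_eq_square simp del: bit_not_zero_iff intro!: sum.neutral)
qed

lemma equiv_bool_cong: "equiv (poly_ring n) (bool_cong n)"
proof (rule equivI)
  show "bool_cong n \<subseteq> poly_ring n \<times> poly_ring n" by (auto simp: bool_cong_def)
  show "refl_on (poly_ring n) (bool_cong n)" by (auto simp: refl_on_def bool_cong_def)
  show "sym (bool_cong n)"
    by (auto simp: sym_def bool_cong_def dest: bool_ideal_uminus)
  show "trans (bool_cong n)"
  proof (rule transI)
    fix p q r assume "(p, q) \<in> bool_cong n" "(q, r) \<in> bool_cong n"
    then show "(p, r) \<in> bool_cong n"
      using bool_ideal_add[of "p - q" n "q - r"] by (auto simp: bool_cong_def)
  qed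
qed

text \<open>
  Interpolation polynomials on the cube: \<open>cube_delta n A\<close> is 1 at the characteristic vector of
  \<open>A\<close> and 0 at the other points.
\<close>

definition cube_delta :: "nat \<Rightarrow> nat set \<Rightarrow> mpoly" where
  "cube_delta n A = (\<Prod>i \<in> A. PolyVar i) * (\<Prod>i \<in> {1..n} - A. 1 - PolyVar i)"

lemma cube_delta_in_poly_ring: "A \<subseteq> {1..n} \<Longrightarrow> cube_delta n A \<in> poly_ring n"
  unfolding cube_delta_def
  by (intro poly_ring_mult poly_ring_prod poly_ring_diff poly_ring_1 poly_ring_Var) auto

lemma sum_cube_delta: "(\<Sum>A \<in> Pow {1..n}. cube_delta n A) = 1"
proof -
  have "(1 :: mpoly) = (\<Prod>i \<in> {1..n}. PolyVar i + (1 - PolyVar i))" by simp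
  also have "\<dots> = (\<Sum>A \<in> Pow {1..n}. cube_delta n A)"
    unfolding cube_delta_def by (rule prod_add) simp
  finally show ?thesis by simp
qed

lemma eval_at_cube_delta:
  assumes "A \<subseteq> {1..n}"
  shows "eval_at (cube_delta n A) x = of_bool (A = {i \<in> {1..n}. x i = 1})"
proof -
  have fin: "finite A" using assms by (rule finite_subset) simp
  have "eval_at (cube_delta n A) x =
          (\<Prod>i \<in> A. of_bool (x i = 1)) * (\<Prod>i \<in> {1..n} - A. of_bool (x i \<noteq> 1))"
    unfolding eval_at_def cube_delta_def poly_eval_simps
    by (intro arg_cong2[of _ _ _ _ "(*)"] prod.cong) (auto simp: bit_val_def)
  also have "\<dots> = of_bool ((\<forall>i \<in> A. x i = 1) \<and> (\<forall>i \<in> {1..n} - A. x i \<noteq> 1))"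
    using fin by (auto intro!: prod.neutral simp: prod_zero_iff)
  also have "(\<forall>i \<in> A. x i = 1) \<and> (\<forall>i \<in> {1..n} - A. x i \<noteq> 1) \<longleftrightarrow> A = {i \<in> {1..n}. x i = 1}"
    using assms by blast
  finally show ?thesis .
qed

lemma var_mult_cube_delta:
  assumes A: "A \<subseteq> {1..n}" and i: "i \<in> {1..n}"
  shows "(PolyVar i - PolyConst (of_bool (i \<in> A))) * cube_delta n A \<in> bool_ideal n"
proof (cases "i \<in> A")
  case True
  let ?r = "(\<Prod>j \<in> A - {i}. PolyVar j) * (\<Prod>j \<in> {1..n} - A. 1 - PolyVar j)"
  have "cube_delta n A = PolyVar i * ?r"
    using True finite_subset[OF A] by (simp add: cube_delta_def prod.remove mult.assoc)
  then have "(PolyVar i - PolyConst (of_bool (i \<in> A))) * cube_delta n A =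
               ?r * (PolyVar i ^ 2 - PolyVar i)"
    using True by (simp add: PolyConst_def algebra_simps power2_eq_square)
  moreover have "?r \<in> poly_ring n"
    using A by (intro poly_ring_mult poly_ring_prod poly_ring_diff poly_ring_1 poly_ring_Var) auto
  ultimately show ?thesis using bool_ideal_mult bool_ideal_gen[OF i] by metis
next
  case False
  let ?r = "(\<Prod>j \<in> A. PolyVar j) * (\<Prod>j \<in> {1..n} - A - {i}. 1 - PolyVar j)"
  have "(\<Prod>j \<in> {1..n} - A. 1 - PolyVar j) = (1 - PolyVar i) * (\<Prod>j \<in> {1..n} - A - {i}. 1 - PolyVar j)"
    using False i by (intro prod.remove) auto
  then have "cube_delta n A = (1 - PolyVar i) * ?r"
    by (simp only: cube_delta_def mult.assoc mult.left_commute)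
  then have "(PolyVar i - PolyConst (of_bool (i \<in> A))) * cube_delta n A =
               (- ?r) * (PolyVar i ^ 2 - PolyVar i)"
    using False by (simp only: PolyConst_def of_bool_eq single_zero) (simp add: algebra_simps power2_eq_square)
  moreover have "- ?r \<in> poly_ring n"
    using A by (intro poly_ring_uminus poly_ring_mult poly_ring_prod poly_ring_diff poly_ring_1 poly_ring_Var) auto
  ultimately show ?thesis using bool_ideal_mult bool_ideal_gen[OF i] by metis
qed

lemma mult_cube_delta:
  assumes A: "A \<subseteq> {1..n}" and p: "p \<in> poly_ring n"
  shows "(p - PolyConst (poly_eval p (\<lambda>i. of_bool (i \<in> A)))) * cube_delta n A \<in> bool_ideal n"
proof -
  let ?c = "\<lambda>p. PolyConst (poly_eval p (\<lambda>i. of_bool (i \<in> A)))"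
  let ?d = "cube_delta n A"
  let ?S = "{p \<in> poly_ring n. (p - ?c p) * ?d \<in> bool_ideal n}"
  have Const_add: "PolyConst (a + b) = PolyConst a + PolyConst b" for a b
    by (simp add: PolyConst_def single_add)
  have Const_mult: "PolyConst (a * b) = PolyConst a * PolyConst b" for a b
    by (simp add: PolyConst_def mult_single)
  have "p \<in> ?S"
  proof (rule poly_ring_generated[OF p])
    show "PolyConst c \<in> ?S" for c by simp
    show "PolyVar i \<in> ?S" if "i \<in> {1..n}" for i
      using that var_mult_cube_delta[OF A that] by (simp add: poly_ring_Var)
  next
    fix p q assume p: "p \<in> ?S" and q: "q \<in> ?S"
    have "(p + q - ?c (p + q)) * ?d = (p - ?c p) * ?d + (q - ?c q) * ?d"
      by (simp add: poly_eval_add Const_add algebra_simps)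
    with p q bool_ideal_add show "p + q \<in> ?S" by (auto intro: poly_ring_add)
    have "(p * q - ?c (p * q)) * ?d = q * ((p - ?c p) * ?d) + ?c p * ((q - ?c q) * ?d)"
      by (simp add: poly_eval_mult Const_mult algebra_simps)
    moreover have "q * ((p - ?c p) * ?d) + ?c p * ((q - ?c q) * ?d) \<in> bool_ideal n"
      using p q by (auto intro!: bool_ideal_add bool_ideal_mult)
    ultimately show "p * q \<in> ?S" using p q by (auto intro: poly_ring_mult)
  qed
  then show ?thesis by blast
qed

lemma bool_ideal_iff_vanishes:
  assumes p: "p \<in> poly_ring n"
  shows "p \<in> bool_ideal n \<longleftrightarrow> (\<forall>x \<in> F2 n. eval_at p x = 0)"
proof
  assume "p \<in> bool_ideal n"
  then show "\<forall>x \<in> F2 n. eval_at p x = 0" by (simp add: eval_at_bool_ideal)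
next
  assume vanish: "\<forall>x \<in> F2 n. eval_at p x = 0"
  have "p * cube_delta n A \<in> bool_ideal n" if A: "A \<subseteq> {1..n}" for A
  proof -
    have "char_vec n A \<in> F2 n" by (simp add: char_vec_def F2_def)
    then have "eval_at p (char_vec n A) = 0" using vanish by blast
    moreover have "eval_at p (char_vec n A) = poly_eval p (\<lambda>i. of_bool (i \<in> A))"
      unfolding eval_at_def poly_eval_def
    proof (intro sum.cong arg_cong2[of _ _ _ _ "(*)"] prod.cong arg_cong2[of _ _ _ _ "(^)"] refl)
      fix m i assume "m \<in> Poly_Mapping.keys p" "i \<in> Poly_Mapping.keys m"
      then have "i \<in> {1..n}" using p unfolding poly_ring_def by blast
      then show "(bit_val (char_vec n A i) :: real) = of_bool (i \<in> A)"
        by (simp add: bit_val_def char_vec_def)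
    qed
    ultimately show ?thesis using mult_cube_delta[OF A p] by (simp add: PolyConst_def)
  qed
  then have "(\<Sum>A \<in> Pow {1..n}. p * cube_delta n A) \<in> bool_ideal n"
    by (intro bool_ideal_sum) auto
  then show "p \<in> bool_ideal n"
    by (simp only: sum_cube_delta mult_1_right flip: sum_distrib_left)
qed

lemma NNF_ex1:
  "\<exists>!C. C \<in> poly_ring n // bool_cong n \<and> (\<forall>p \<in> C. \<forall>x \<in> F2 n. eval_at p x = \<phi> x)"
proof -
  define p where "p = (\<Sum>A \<in> Pow {1..n}. PolyConst (\<phi> (char_vec n A)) * cube_delta n A)"
  have p: "p \<in> poly_ring n"
    unfolding p_def by (intro poly_ring_sum poly_ring_mult poly_ring_Const cube_delta_in_poly_ring) auto
  have eval_p: "eval_at p x = \<phi> x" if x: "x \<in> F2 n" for x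
  proof -
    let ?A = "{i \<in> {1..n}. x i = 1}"
    have "eval_at p x = (\<Sum>A \<in> Pow {1..n}. \<phi> (char_vec n A) * eval_at (cube_delta n A) x)"
      by (simp add: p_def eval_at_def poly_eval_simps)
    also have "\<dots> = (\<Sum>A \<in> Pow {1..n}. if A = ?A then \<phi> (char_vec n A) else 0)"
      by (rule sum.cong) (simp_all add: eval_at_cube_delta)
    also have "\<dots> = \<phi> (char_vec n ?A)"
      by (subst sum.delta) auto
    also have "char_vec n ?A = x"
    proof
      fix i
      show "char_vec n ?A i = x i"
        using x PiE_arb[of x "{1..n}" "\<lambda>_. UNIV" i]
        by (cases "i \<in> {1..n}"; cases "x i") (simp_all add: char_vec_def F2_def)
    qed
    finally show ?thesis .
  qed
  have cong_iff: "q \<in> bool_cong n `` {p} \<longleftrightarrow> q \<in> poly_ring n \<and> (\<forall>x \<in> F2 n. eval_at q x = \<phi> x)" for q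
    using p eval_p bool_ideal_iff_vanishes[OF poly_ring_diff[OF p], of q]
    by (auto simp: bool_cong_def eval_at_def poly_eval_diff)
  show ?thesis
  proof (intro ex1I[of _ "bool_cong n `` {p}"] conjI)
    show "bool_cong n `` {p} \<in> poly_ring n // bool_cong n" using p by (rule quotientI)
    show "\<forall>q \<in> bool_cong n `` {p}. \<forall>x \<in> F2 n. eval_at q x = \<phi> x" using cong_iff by blast
  next
    fix C assume C: "C \<in> poly_ring n // bool_cong n \<and> (\<forall>q \<in> C. \<forall>x \<in> F2 n. eval_at q x = \<phi> x)"
    then obtain q where q: "q \<in> poly_ring n" "C = bool_cong n `` {q}" by (auto elim: quotientE)
    then have "q \<in> C" using equiv_class_self[OF equiv_bool_cong] by blast
    with C q(1) have "(p, q) \<in> bool_cong n" using cong_iff by blast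
    with q(2) show "C = bool_cong n `` {p}" using equiv_class_eq[OF equiv_bool_cong] by metis
  qed
qed

definition FH_poly :: "'v multigraph \<Rightarrow> mpoly set" where
  "FH_poly G = NNF (card (edges G))
     (\<lambda>u. real_of_int (fourier_hadamard (card (edges G)) (tree_function G) u))"

end

theory Submission
  imports Defs
begin

text \<open>The map \<open>b\<close> \<mapsto> \<open>(- 1) ^ b\<close> is a character of the
  additive group of the two-element field, so the sign attached to a tree factors over coordinates
  (\<open>minus_one_power_bit_val_sum\<close>). Coordinates outside the tree contribute 1; an edge
  \<open>i\<close> of it contributes \<open>1 - 2 * x i\<close>, the affine form of the sign on
  bits. Summing over trees gives the transform, and evaluating its normal form gives the transform
  back (\<open>class_eval_NNF\<close>).\<close>

lemma class_eval_NNF: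
  assumes "x \<in> F2 n"
  shows "class_eval (NNF n \<phi>) x = \<phi> x"
proof -
  have C: "NNF n \<phi> \<in> poly_ring n // bool_cong n"
    and eval: "\<forall>p \<in> NNF n \<phi>. \<forall>x \<in> F2 n. eval_at p x = \<phi> x"
    using theI'[OF NNF_ex1[of n \<phi>]] by (simp_all add: NNF_def)
  \<comment> \<open>A representative is needed for uniqueness in \<open>class_eval\<close>: over an
    empty class every value would qualify.\<close>
  obtain p where "p \<in> NNF n \<phi>"
    using in_quotient_imp_non_empty[OF equiv_bool_cong C] by blast
  with eval assms show ?thesis
    unfolding class_eval_def by (intro the_equality) auto
qed

lemma minus_one_power_bit_val:
  "(- 1) ^ bit_val b = (1 - 2 * bit_val b :: 'a::comm_ring_1)"
  by (cases b) (simp_all add: bit_val_def)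

lemma minus_one_power_bit_val_sum:
  "(- 1) ^ bit_val (\<Sum>i \<in> A. f i) = (\<Prod>i \<in> A. (- 1) ^ bit_val (f i) :: 'a::comm_ring_1)"
proof (induction A rule: infinite_finite_induct)
  case (insert i A)
  have "(- 1) ^ bit_val (a + b) = ((- 1) ^ bit_val a * (- 1) ^ bit_val b :: 'a)" for a b
    by (cases a; cases b) (simp_all add: bit_val_def)
  with insert show ?case by simp
\<comment> \<open>For infinite \<open>A\<close> the sum defaults to 0 and the product to 1, which
  agree since \<open>(- 1) ^ 0 = 1\<close>.\<close>
qed (simp_all add: bit_val_def)

lemma minus_one_power_dot_char_vec:
  assumes "S \<subseteq> {1..n}"
  shows "(- 1) ^ bit_val (dot n (char_vec n S) x) =
           (\<Prod>i \<in> S. 1 - 2 * bit_val (x i) :: 'a::comm_ring_1)"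
  unfolding dot_def minus_one_power_bit_val_sum
  \<comment> \<open>Off \<open>S\<close> the dot product has summand 0, hence factor 1, so the
    product over \<open>{1..n}\<close> shrinks to \<open>S\<close>.\<close>
  using assms by (intro prod.mono_neutral_cong_right) (auto simp: char_vec_def minus_one_power_bit_val bit_val_def[of 0])

theorem proposition1:
  fixes G :: "'v multigraph" and n :: nat and x :: "nat \<Rightarrow> bit"
  assumes "finite_multigraph G"
    and "n = card (edges G)"
    and "edges G = {1..n}"
    and "x \<in> F2 n"
  shows "class_eval (FH_poly G) x =
           real_of_int (\<Sum>T \<in> spanning_trees G. \<Prod>i \<in> edges T. 1 - 2 * bit_val (x i))"
proof -
  have "edges T \<subseteq> {1..n}" if "T \<in> spanning_trees G" for T
    using that assms(3) by (auto simp: spanning_trees_def subgraph_def)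
  then have "fourier_hadamard n (tree_function G) x =
               (\<Sum>T \<in> spanning_trees G. \<Prod>i \<in> edges T. 1 - 2 * bit_val (x i))"
    unfolding fourier_hadamard_tree_function[OF assms(3)]
    by (intro sum.cong minus_one_power_dot_char_vec refl)
  moreover have "class_eval (FH_poly G) x = real_of_int (fourier_hadamard n (tree_function G) x)"
    using assms(2,4) by (simp add: FH_poly_def class_eval_NNF)
  ultimately show ?thesis by simp
qed

end
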